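(* Let $\theta\in(0,1]$, $r>0$, $s>0$ satisfy $rs<1/\|\mathcal{L}\mathcal{L}^*\|$, and let $\rho,\sigma$ satisfy: $\rho=\sigma\in(0,2)$ if $\theta=1$; and $\rho\in(0,1+\theta-\sqrt{1-\theta}\,]$, $\sigma=\rho/\theta$ if $\theta\in(0,1)$. Let $\{w^k=(u_0^k,p^k)^\top\}$ be the sequence generated, from arbitrary initial values $(u_0^0,p^0)\in L^2(\Omega)\times L^2(\Omega)$, by the generalized primal-dual algorithm (described in the context) with these parameters, and let $w^*=(u_0^*,p^* )^\top$ be the solution (saddle point) of $$\min_{u_0\in L^2(\Omega)}\max_{p\in L^2(\Omega)}\Big(g(u_0)+\int_\Omega p\,\mathcal{L}u_0\,dx-f^*(p)\Big).$$ Then $u_0^k\to u_0^*$ strongly in $L^2(\Omega)$ and $p^k\to p^*$ strongly in $L^2(\Omega)$ as $k\to\infty$.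
   Context: Setting. $\Omega\subset\mathbb{R}^N$, $N\ge1$, is a bounded domain, $0<T<\infty$, $d>0$ is a constant, $v\in\mathbb{R}^N$ is a constant vector, $u_T\in L^2(\Omega)$ is given, and $\tau>0$, $\beta>0$ are constants. $\mathcal{L}:L^2(\Omega)\to L^2(\Omega)$ is the (bounded linear) solution operator $\mathcal{L}u_0=u(\cdot,T)$ of $$\partial_t u-d\Delta u+v\cdot\nabla u=0\ \text{in }\Omega\times(0,T),\quad u=0\ \text{on }\partial\Omega\times(0,T),\quad u(\cdot,0)=u_0,$$ and $\mathcal{L}^*$ is its adjoint. $\|\mathcal{L}\mathcal{L}^*\|$ is the operator norm. Functionals. $g(u_0)=\frac{\tau}{2}\int_\Omega|u_0|^2dx+\beta\int_\Omega|u_0|dx$, and $f^*(p)=\frac12\int_\Omega|p|^2dx+\int_\Omega p\,u_T\,dx$, which is the convex conjugate of $f(q)=\frac12\int_\Omega|q-u_T|^2dx$. The saddle point problem is a reformulation of $\min_{u_0\in L^2(\Omega)} \frac12\|\mathcal{L}u_0-u_T\|^2_{L^2(\Omega)}+\frac{\tau}{2}\|u_0\|_{L^2(\Omega)}^2+\beta\|u_0\|_{L^1(\Omega)}$. Generalized primal-dual algorithm. Given $(u_0^0,p^0)\in L^2(\Omega)\times L^2(\Omega)$, for $k=0,1,2,\dots$ compute $$\widetilde u_0^k=\arg\min_{u_0\in L^2(\Omega)}\Big(g(u_0)+\int_\Omega p^k\mathcal{L}u_0\,dx+\tfrac1{2r}\|u_0-u_0^k\|^2_{L^2(\Omega)}\Big),$$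 $$\bar u_0^k=\widetilde u_0^k+\theta(\widetilde u_0^k-u_0^k),$$ $$\widetilde p^{\,k}=\arg\max_{p\in L^2(\Omega)}\Big(\int_\Omega p\,\mathcal{L}\bar u_0^k\,dx-f^*(p)-\tfrac1{2s}\|p-p^k\|^2_{L^2(\Omega)}\Big),$$ $$u_0^{k+1}=u_0^k-\rho(u_0^k-\widetilde u_0^k),\qquad p^{k+1}=p^k-\sigma(p^k-\widetilde p^{\,k}).$$ *)

theory Defs
  imports "HOL-Analysis.Analysis"
begin

section \<open>Square-integrable functions\<close>

text \<open>
  Elements of \<open>L\<^sup>2(M)\<close> are represented by functions, not by equivalence classes; hence
  \<open>L2_norm\<close> is only a seminorm, and identities between elements of \<open>L\<^sup>2(M)\<close> are
  identities almost everywhere.  On a domain \<open>\<Omega>\<close> the measure is \<open>lebesgue_on \<Omega>\<close>.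
\<close>

definition L2 :: "'a measure \<Rightarrow> ('a \<Rightarrow> 'b::euclidean_space) set" where
  "L2 M = {f \<in> borel_measurable M. integrable M (\<lambda>x. (norm (f x))\<^sup>2)}"

definition L2_inner :: "'a measure \<Rightarrow> ('a \<Rightarrow> 'b::euclidean_space) \<Rightarrow> ('a \<Rightarrow> 'b) \<Rightarrow> real" where
  "L2_inner M f g = (LINT x|M. f x \<bullet> g x)"

definition L2_norm :: "'a measure \<Rightarrow> ('a \<Rightarrow> 'b::euclidean_space) \<Rightarrow> real" where
  "L2_norm M f = sqrt (LINT x|M. (norm (f x))\<^sup>2)"

definition L2_bounded_linear :: "'a measure \<Rightarrow> (('a \<Rightarrow> real) \<Rightarrow> ('a \<Rightarrow> real)) \<Rightarrow> bool" where
  "L2_bounded_linear M A \<longleftrightarrow>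
     (\<forall>f\<in>L2 M. A f \<in> L2 M) \<and>
     (\<forall>f\<in>L2 M. \<forall>g\<in>L2 M. AE x in M. A (\<lambda>y. f y + g y) x = A f x + A g x) \<and>
     (\<forall>f\<in>L2 M. \<forall>c. AE x in M. A (\<lambda>y. c * f y) x = c * A f x) \<and>
     (\<exists>C. \<forall>f\<in>L2 M. L2_norm M (A f) \<le> C * L2_norm M f)"

definition L2_adjoint ::
  "'a measure \<Rightarrow> (('a \<Rightarrow> real) \<Rightarrow> ('a \<Rightarrow> real)) \<Rightarrow> (('a \<Rightarrow> real) \<Rightarrow> ('a \<Rightarrow> real)) \<Rightarrow> bool" where
  "L2_adjoint M A B \<longleftrightarrow>
     (\<forall>p\<in>L2 M. B p \<in> L2 M) \<and>
     (\<forall>f\<in>L2 M. \<forall>p\<in>L2 M. L2_inner M (A f) p = L2_inner M f (B p))"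

definition L2_onorm :: "'a measure \<Rightarrow> (('a \<Rightarrow> real) \<Rightarrow> ('a \<Rightarrow> real)) \<Rightarrow> real" where
  "L2_onorm M A = (SUP f\<in>{f \<in> L2 M. L2_norm M f \<le> 1}. L2_norm M (A f))"


section \<open>The Sobolev space with zero boundary values\<close>

definition grad :: "(real^'n \<Rightarrow> real) \<Rightarrow> real^'n \<Rightarrow> real^'n" where
  "grad f x = (\<chi> i. frechet_derivative f (at x) (axis i 1))"

primrec C_k :: "nat \<Rightarrow> (real^'n \<Rightarrow> real) \<Rightarrow> bool" where
  "C_k 0 f \<longleftrightarrow> continuous_on UNIV f"
| "C_k (Suc k) f \<longleftrightarrow> f differentiable_on UNIV \<and> (\<forall>i. C_k k (\<lambda>x. grad f x $ i))"

definition test_functions :: "(real^'n) set \<Rightarrow> (real^'n \<Rightarrow> real) set" where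
  "test_functions \<Omega> =
     {\<phi>. (\<forall>k. C_k k \<phi>) \<and> (\<exists>K. compact K \<and> K \<subseteq> \<Omega> \<and> (\<forall>x. x \<notin> K \<longrightarrow> \<phi> x = 0))}"

definition has_weak_grad ::
  "(real^'n) set \<Rightarrow> (real^'n \<Rightarrow> real) \<Rightarrow> (real^'n \<Rightarrow> real^'n) \<Rightarrow> bool" where
  "has_weak_grad \<Omega> u G \<longleftrightarrow>
     (\<forall>\<phi>\<in>test_functions \<Omega>.
        (LINT x|lebesgue_on \<Omega>. u x *\<^sub>R grad \<phi> x) = - (LINT x|lebesgue_on \<Omega>. \<phi> x *\<^sub>R G x))"

text \<open>
  \<open>u \<in> H\<^sup>1\<^sub>0(\<Omega>)\<close> with weak gradient \<open>G\<close>, where \<open>H\<^sup>1\<^sub>0(\<Omega>)\<close> is the closure of the test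
  functions in \<open>H\<^sup>1(\<Omega>)\<close>.
\<close>

definition H10_with_grad ::
  "(real^'n) set \<Rightarrow> (real^'n \<Rightarrow> real) \<Rightarrow> (real^'n \<Rightarrow> real^'n) \<Rightarrow> bool" where
  "H10_with_grad \<Omega> u G \<longleftrightarrow>
     u \<in> L2 (lebesgue_on \<Omega>) \<and> G \<in> L2 (lebesgue_on \<Omega>) \<and> has_weak_grad \<Omega> u G \<and>
     (\<forall>e>0. \<exists>\<phi>\<in>test_functions \<Omega>.
        L2_norm (lebesgue_on \<Omega>) (\<lambda>x. u x - \<phi> x) < e \<and>
        L2_norm (lebesgue_on \<Omega>) (\<lambda>x. G x - grad \<phi> x) < e)"


section \<open>The advection-diffusion equation and its solution operator\<close>

text \<open>
  Weak solutions of \<open>\<partial>\<^sub>t u - d \<Delta>u + v \<cdot> \<nabla>u = 0\<close> in \<open>\<Omega> \<times> (0,T)\<close>, \<open>u = 0\<close> on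
  \<open>\<partial>\<Omega> \<times> (0,T)\<close>, \<open>u(\<cdot>,0) = u0\<close>:  \<open>u\<close> lies in \<open>C([0,T]; L\<^sup>2(\<Omega>))\<close> and in
  \<open>L\<^sup>2(0,T; H\<^sup>1\<^sub>0(\<Omega>))\<close> (the function \<open>G\<close> is its spatial weak gradient), and the equation,
  tested with a fixed \<open>\<phi>\<close> in \<open>C\<^sub>c\<^sup>\<infinity>(\<Omega>)\<close>, holds integrated over \<open>(0,t)\<close> for every \<open>t\<close>.
  No regularity of the boundary is needed for this notion.
\<close>

definition weak_solution ::
  "(real^'n) set \<Rightarrow> real \<Rightarrow> real \<Rightarrow> real^'n \<Rightarrow> (real^'n \<Rightarrow> real) \<Rightarrow> (real \<Rightarrow> real^'n \<Rightarrow> real) \<Rightarrow> bool"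
  where
  "weak_solution \<Omega> T d v u0 u \<longleftrightarrow>
     (\<forall>t\<in>{0..T}. u t \<in> L2 (lebesgue_on \<Omega>)) \<and>
     (\<forall>t\<in>{0..T}.
        ((\<lambda>s. L2_norm (lebesgue_on \<Omega>) (\<lambda>x. u s x - u t x)) \<longlongrightarrow> 0) (at t within {0..T})) \<and>
     (\<exists>G :: real \<Rightarrow> real^'n \<Rightarrow> real^'n.
        (\<lambda>(t, x). G t x) \<in> L2 (lebesgue_on ({0..T} \<times> \<Omega>)) \<and>
        (AE t in lebesgue_on {0..T}. H10_with_grad \<Omega> (u t) (G t)) \<and>
        (\<forall>\<phi>\<in>test_functions \<Omega>. \<forall>t\<in>{0..T}.
           L2_inner (lebesgue_on \<Omega>) (u t) \<phi> - L2_inner (lebesgue_on \<Omega>) (u 0) \<phi>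
           + (LINT s|lebesgue_on {0..t}.
                d * L2_inner (lebesgue_on \<Omega>) (G s) (grad \<phi>)
                + L2_inner (lebesgue_on \<Omega>) (\<lambda>x. v \<bullet> G s x) \<phi>) = 0)) \<and>
     (AE x in lebesgue_on \<Omega>. u 0 x = u0 x)"

definition solution_operator ::
  "(real^'n) set \<Rightarrow> real \<Rightarrow> real \<Rightarrow> real^'n \<Rightarrow> ((real^'n \<Rightarrow> real) \<Rightarrow> (real^'n \<Rightarrow> real)) \<Rightarrow> bool" where
  "solution_operator \<Omega> T d v L \<longleftrightarrow>
     (\<forall>u0\<in>L2 (lebesgue_on \<Omega>). L u0 \<in> L2 (lebesgue_on \<Omega>) \<and>
        (\<exists>u. weak_solution \<Omega> T d v u0 u \<and> (AE x in lebesgue_on \<Omega>. L u0 x = u T x)))"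


section \<open>The saddle point problem and the primal-dual algorithm\<close>

definition g_fun :: "'a measure \<Rightarrow> real \<Rightarrow> real \<Rightarrow> ('a \<Rightarrow> real) \<Rightarrow> real" where
  "g_fun M \<tau> \<beta> u = \<tau> / 2 * (LINT x|M. \<bar>u x\<bar>\<^sup>2) + \<beta> * (LINT x|M. \<bar>u x\<bar>)"

definition f_conj :: "'a measure \<Rightarrow> ('a \<Rightarrow> real) \<Rightarrow> ('a \<Rightarrow> real) \<Rightarrow> real" where
  "f_conj M uT p = 1 / 2 * (LINT x|M. \<bar>p x\<bar>\<^sup>2) + (LINT x|M. p x * uT x)"

definition lagrangian ::
  "'a measure \<Rightarrow> real \<Rightarrow> real \<Rightarrow> ('a \<Rightarrow> real) \<Rightarrow> (('a \<Rightarrow> real) \<Rightarrow> ('a \<Rightarrow> real))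
     \<Rightarrow> ('a \<Rightarrow> real) \<Rightarrow> ('a \<Rightarrow> real) \<Rightarrow> real" where
  "lagrangian M \<tau> \<beta> uT L u p = g_fun M \<tau> \<beta> u + (LINT x|M. p x * L u x) - f_conj M uT p"

definition saddle_point ::
  "'a measure \<Rightarrow> (('a \<Rightarrow> real) \<Rightarrow> ('a \<Rightarrow> real) \<Rightarrow> real) \<Rightarrow> ('a \<Rightarrow> real) \<Rightarrow> ('a \<Rightarrow> real) \<Rightarrow> bool" where
  "saddle_point M \<Phi> us ps \<longleftrightarrow>
     us \<in> L2 M \<and> ps \<in> L2 M \<and>
     (\<forall>p\<in>L2 M. \<Phi> us p \<le> \<Phi> us ps) \<and> (\<forall>u\<in>L2 M. \<Phi> us ps \<le> \<Phi> u ps)"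

definition gpd_iterates ::
  "'a measure \<Rightarrow> real \<Rightarrow> real \<Rightarrow> ('a \<Rightarrow> real) \<Rightarrow> (('a \<Rightarrow> real) \<Rightarrow> ('a \<Rightarrow> real))
     \<Rightarrow> real \<Rightarrow> real \<Rightarrow> real \<Rightarrow> real \<Rightarrow> real
     \<Rightarrow> (nat \<Rightarrow> 'a \<Rightarrow> real) \<Rightarrow> (nat \<Rightarrow> 'a \<Rightarrow> real) \<Rightarrow> bool" where
  "gpd_iterates M \<tau> \<beta> uT L r s \<theta> \<rho> \<sigma> u p \<longleftrightarrow>
     u 0 \<in> L2 M \<and> p 0 \<in> L2 M \<and>
     (\<forall>k. \<exists>ut ub pt.
        is_arg_min
          (\<lambda>w. g_fun M \<tau> \<beta> w + (LINT x|M. p k x * L w x)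
               + 1 / (2 * r) * (L2_norm M (\<lambda>x. w x - u k x))\<^sup>2)
          (\<lambda>w. w \<in> L2 M) ut \<and>
        ub = (\<lambda>x. ut x + \<theta> * (ut x - u k x)) \<and>
        is_arg_max
          (\<lambda>q. (LINT x|M. q x * L ub x) - f_conj M uT q
               - 1 / (2 * s) * (L2_norm M (\<lambda>x. q x - p k x))\<^sup>2)
          (\<lambda>q. q \<in> L2 M) pt \<and>
        u (Suc k) \<in> L2 M \<and> p (Suc k) \<in> L2 M \<and>
        (AE x in M. u (Suc k) x = u k x - \<rho> * (u k x - ut x)) \<and>
        (AE x in M. p (Suc k) x = p k x - \<sigma> * (p k x - pt x)))"

end

theory Submission
  imports Defs
begin

text \<open>
  This is a fact about saddle point problems that couple two strongly convex objectives, here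
  with moduli \<open>\<tau>\<close> and \<open>1\<close>, by a bounded linear operator with an adjoint: the weighted
  distance of the iterates to the saddle point decreases, and strong convexity makes the
  decrease control the distance itself.

  Write \<open>x = u\<^sub>0\<^sup>k - u\<^sub>0\<^sup>*\<close>, \<open>y = p\<^sup>k - p\<^sup>*\<close> for the error of an iterate, and split it as
  \<open>(x, y) = (e, f) + (a, b)\<close>, where \<open>(e, f)\<close> is the error of the predicted pair.  Each
  prediction minimizes a quadratic plus a multiple of the \<open>L\<^sup>1\<close> norm, so it satisfies a
  variational inequality (\<open>energy_minimizer_variational_inequality\<close>); adding those of the
  saddle point gives
  \<open>\<tau> \<parallel>e\<parallel>\<^sup>2 + \<parallel>f\<parallel>\<^sup>2 \<le> \<langle>e, a\<rangle> / r + \<langle>f, b\<rangle> / s - \<langle>L e, b\<rangle> - \<theta> \<langle>L a, f\<rangle>\<close>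
  (\<open>prediction_monotone\<close>).  Twice the right-hand side plus a quadratic form in \<open>(a, b)\<close>, all
  multiplied by \<open>\<rho>\<close>, is the decrease in one step of
  \<open>V(x, y) = \<parallel>x\<parallel>\<^sup>2 / r - 2 \<theta> \<langle>L x, y\<rangle> + (\<theta> / s) \<parallel>y\<parallel>\<^sup>2\<close>
  (\<open>lyapunov_step_identity\<close>, which uses \<open>\<theta> \<sigma> = \<rho>\<close>).  The bound on \<open>\<rho>\<close> and the condition
  \<open>r s \<parallel>L L\<^sup>*\<parallel> < 1\<close> make that form coercive (\<open>correction_form_coercive\<close>) and \<open>V\<close>
  nonnegative (\<open>lyapunov_nonneg\<close>).

  Hence every step lowers \<open>V\<close> by at least a fixed multiple of
  \<open>\<parallel>e\<parallel>\<^sup>2 + \<parallel>f\<parallel>\<^sup>2 + \<parallel>a\<parallel>\<^sup>2 + \<parallel>b\<parallel>\<^sup>2\<close>, thus of \<open>\<parallel>x\<parallel>\<^sup>2 + \<parallel>y\<parallel>\<^sup>2\<close>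
  (\<open>primal_dual_step_dissipation\<close>).  A nonnegative sequence cannot decrease by amounts that
  do not tend to zero, so the errors tend to zero strongly.
\<close>

section \<open>The space of square-integrable functions\<close>

lemma L2_integrable_mult:
  fixes f g :: "'a \<Rightarrow> real"
  assumes "f \<in> L2 M" "g \<in> L2 M"
  shows "integrable M (\<lambda>x. f x * g x)"
proof (rule Bochner_Integration.integrable_bound)
  show "integrable M (\<lambda>x. (norm (f x))\<^sup>2 + (norm (g x))\<^sup>2)"
    using assms by (auto simp: L2_def)
  show "(\<lambda>x. f x * g x) \<in> borel_measurable M"
    using assms by (auto simp: L2_def)
  have "\<bar>a * b\<bar> \<le> a\<^sup>2 + b\<^sup>2" for a b :: real
  proof -
    have "\<bar>a * b\<bar> \<le> 2 * \<bar>a\<bar> * \<bar>b\<bar>"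
      by (simp add: abs_mult)
    also have "\<dots> \<le> a\<^sup>2 + b\<^sup>2"
      using sum_squares_bound[of "\<bar>a\<bar>" "\<bar>b\<bar>"] by simp
    finally show ?thesis .
  qed
  then show "AE x in M. norm (f x * g x) \<le> norm ((norm (f x))\<^sup>2 + (norm (g x))\<^sup>2)"
    by simp
qed

lemma L2_real_iff:
  fixes f :: "'a \<Rightarrow> real"
  shows "f \<in> L2 M \<longleftrightarrow> f \<in> borel_measurable M \<and> integrable M (\<lambda>x. (f x)\<^sup>2)"
  by (simp add: L2_def)

lemma L2_zero [simp]: "(\<lambda>x. 0 :: real) \<in> L2 M"
  by (simp add: L2_real_iff)

lemma L2_scale [simp]:
  fixes f :: "'a \<Rightarrow> real"
  assumes "f \<in> L2 M"
  shows "(\<lambda>x. c * f x) \<in> L2 M"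
  using assms by (auto simp: L2_real_iff power_mult_distrib)

lemma L2_add [simp]:
  fixes f g :: "'a \<Rightarrow> real"
  assumes "f \<in> L2 M" "g \<in> L2 M"
  shows "(\<lambda>x. f x + g x) \<in> L2 M"
  using assms L2_integrable_mult[OF assms]
  by (auto simp: L2_real_iff power2_sum mult.assoc)

lemma L2_diff [simp]:
  fixes f g :: "'a \<Rightarrow> real"
  assumes "f \<in> L2 M" "g \<in> L2 M"
  shows "(\<lambda>x. f x - g x) \<in> L2 M"
  using L2_add[OF assms(1) L2_scale[OF assms(2), of "-1"]] by simp

lemma L2_inner_real:
  fixes f g :: "'a \<Rightarrow> real"
  shows "L2_inner M f g = (LINT x|M. f x * g x)"
  by (simp add: L2_inner_def)

lemma L2_inner_commute:
  fixes f g :: "'a \<Rightarrow> real"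
  shows "L2_inner M f g = L2_inner M g f"
  by (simp add: L2_inner_real mult.commute)

lemma L2_inner_add_left [simp]:
  fixes f g h :: "'a \<Rightarrow> real"
  assumes "f \<in> L2 M" "g \<in> L2 M" "h \<in> L2 M"
  shows "L2_inner M (\<lambda>x. f x + g x) h = L2_inner M f h + L2_inner M g h"
  using assms by (simp add: L2_inner_real distrib_right L2_integrable_mult)

lemma L2_inner_diff_left [simp]:
  fixes f g h :: "'a \<Rightarrow> real"
  assumes "f \<in> L2 M" "g \<in> L2 M" "h \<in> L2 M"
  shows "L2_inner M (\<lambda>x. f x - g x) h = L2_inner M f h - L2_inner M g h"
  using assms by (simp add: L2_inner_real left_diff_distrib L2_integrable_mult)

lemma L2_inner_scale_left [simp]:
  fixes f h :: "'a \<Rightarrow> real"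
  shows "L2_inner M (\<lambda>x. c * f x) h = c * L2_inner M f h"
  by (simp add: L2_inner_real mult.assoc)

lemma L2_inner_add_right [simp]:
  fixes f g h :: "'a \<Rightarrow> real"
  assumes "f \<in> L2 M" "g \<in> L2 M" "h \<in> L2 M"
  shows "L2_inner M h (\<lambda>x. f x + g x) = L2_inner M h f + L2_inner M h g"
  using L2_inner_add_left[OF assms] by (simp add: L2_inner_commute)

lemma L2_inner_diff_right [simp]:
  fixes f g h :: "'a \<Rightarrow> real"
  assumes "f \<in> L2 M" "g \<in> L2 M" "h \<in> L2 M"
  shows "L2_inner M h (\<lambda>x. f x - g x) = L2_inner M h f - L2_inner M h g"
  using L2_inner_diff_left[OF assms] by (simp add: L2_inner_commute)

lemma L2_inner_scale_right [simp]:
  fixes f h :: "'a \<Rightarrow> real"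
  shows "L2_inner M h (\<lambda>x. c * f x) = c * L2_inner M h f"
  by (metis L2_inner_commute L2_inner_scale_left)

lemma L2_inner_cong_AE:
  fixes f f' g g' :: "'a \<Rightarrow> real"
  assumes "f \<in> L2 M" "f' \<in> L2 M" "g \<in> L2 M" "g' \<in> L2 M"
    and "AE x in M. f x = f' x" "AE x in M. g x = g' x"
  shows "L2_inner M f g = L2_inner M f' g'"
  unfolding L2_inner_real
proof (rule integral_cong_AE)
  show "AE x in M. f x * g x = f' x * g' x"
    using assms(5,6) by eventually_elim simp
qed (use assms(1-4) in \<open>auto simp: L2_real_iff\<close>)

lemma L2_norm_power2:
  fixes f :: "'a \<Rightarrow> real"
  shows "(L2_norm M f)\<^sup>2 = L2_inner M f f"
  by (simp add: L2_norm_def L2_inner_real power2_eq_square)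

lemma L2_norm_eq_sqrt:
  fixes f :: "'a \<Rightarrow> real"
  shows "L2_norm M f = sqrt (L2_inner M f f)"
  by (simp add: L2_norm_def L2_inner_real power2_eq_square)

lemma L2_norm_nonneg [simp]: "0 \<le> L2_norm M f"
  by (simp add: L2_norm_def)

lemma L2_inner_self_nonneg [simp]:
  fixes f :: "'a \<Rightarrow> real"
  shows "0 \<le> L2_inner M f f"
  by (simp add: L2_inner_real)

lemma L2_norm_scale:
  fixes f :: "'a \<Rightarrow> real"
  shows "L2_norm M (\<lambda>x. c * f x) = \<bar>c\<bar> * L2_norm M f"
proof -
  have "L2_inner M (\<lambda>x. c * f x) (\<lambda>x. c * f x) = c\<^sup>2 * L2_inner M f f"
    by (simp add: power2_eq_square)
  then show ?thesis
    by (simp add: L2_norm_eq_sqrt real_sqrt_mult)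
qed

lemma L2_Cauchy_Schwarz:
  fixes f g :: "'a \<Rightarrow> real"
  assumes f: "f \<in> L2 M" and g: "g \<in> L2 M"
  shows "\<bar>L2_inner M f g\<bar> \<le> L2_norm M f * L2_norm M g"
proof -
  define a b c where "a = L2_inner M f f" and "b = L2_inner M g g" and "c = L2_inner M f g"
  have quad: "0 \<le> a + 2 * t * c + t\<^sup>2 * b" for t
  proof -
    have "0 \<le> L2_inner M (\<lambda>x. f x + t * g x) (\<lambda>x. f x + t * g x)"
      by simp
    also have "\<dots> = a + 2 * t * c + t\<^sup>2 * b"
      using f g by (simp add: a_def b_def c_def L2_inner_commute[of M g f]
          power2_eq_square algebra_simps)
    finally show ?thesis .
  qed
  have "c\<^sup>2 \<le> a * b"
  proof (cases "b = 0")
    case True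
    (* The quadratic in t degenerates to an affine function, bounded below only if c = 0. *)
    have "c = 0"
    proof (rule ccontr)
      assume "c \<noteq> 0"
      then show False
        using quad[of "- (a + 1) / (2 * c)"] True by (simp add: field_simps)
    qed
    then show ?thesis using True by simp
  next
    case False
    then have "b > 0"
      using L2_inner_self_nonneg[of M g] unfolding b_def by linarith
    have "0 \<le> b * (a + 2 * (- c / b) * c + (- c / b)\<^sup>2 * b)"
      using quad[of "- c / b"] \<open>b > 0\<close> by simp
    also have "\<dots> = a * b - c\<^sup>2"
      using \<open>b > 0\<close> by (simp add: field_simps power2_eq_square)
    finally show ?thesis by simp
  qed
  then have "sqrt (c\<^sup>2) \<le> sqrt (a * b)"
    by (rule real_sqrt_le_mono)
  then show ?thesis
    by (simp add: a_def b_def c_def L2_norm_eq_sqrt real_sqrt_mult)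
qed

lemma (in finite_measure) L2_integrable_abs:
  fixes f :: "'a \<Rightarrow> real"
  assumes "f \<in> L2 M"
  shows "integrable M (\<lambda>x. \<bar>f x\<bar>)"
proof (rule Bochner_Integration.integrable_bound)
  show "integrable M (\<lambda>x. 1 + (f x)\<^sup>2)"
    using assms by (auto simp: L2_real_iff)
  show "(\<lambda>x. \<bar>f x\<bar>) \<in> borel_measurable M"
    using assms by (auto simp: L2_real_iff)
  have "\<bar>a\<bar> \<le> 1 + a\<^sup>2" for a :: real
    using sum_squares_bound[of 1 "\<bar>a\<bar>"] by simp
  then show "AE x in M. norm \<bar>f x\<bar> \<le> norm (1 + (f x)\<^sup>2)"
    by simp
qed

section \<open>Operators with an adjoint\<close>

context
  fixes M :: "'a measure" and A B :: "('a \<Rightarrow> real) \<Rightarrow> ('a \<Rightarrow> real)"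
  assumes bl: "L2_bounded_linear M A" and adj: "L2_adjoint M A B"
begin

lemma L2_operator_mem: "f \<in> L2 M \<Longrightarrow> A f \<in> L2 M"
  using bl by (simp add: L2_bounded_linear_def)

lemma L2_adjoint_mem: "p \<in> L2 M \<Longrightarrow> B p \<in> L2 M"
  using adj by (simp add: L2_adjoint_def)

lemma L2_adjoint_eq: "f \<in> L2 M \<Longrightarrow> p \<in> L2 M \<Longrightarrow> L2_inner M (A f) p = L2_inner M f (B p)"
  using adj by (simp add: L2_adjoint_def)

lemma L2_norm_adjoint_sq:
  assumes "p \<in> L2 M"
  shows "(L2_norm M (B p))\<^sup>2 \<le> L2_norm M (A (B p)) * L2_norm M p"
proof -
  have "(L2_norm M (B p))\<^sup>2 = L2_inner M (A (B p)) p"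
    using assms by (simp add: L2_norm_power2 L2_adjoint_eq L2_adjoint_mem)
  also have "\<dots> \<le> L2_norm M (A (B p)) * L2_norm M p"
    using L2_Cauchy_Schwarz[of "A (B p)" M p] assms by (simp add: L2_operator_mem L2_adjoint_mem)
  finally show ?thesis .
qed

lemma L2_comp_adjoint_bounded:
  obtains C where "\<And>p. p \<in> L2 M \<Longrightarrow> L2_norm M (A (B p)) \<le> C * L2_norm M p"
proof -
  obtain C0 where C0: "\<And>f. f \<in> L2 M \<Longrightarrow> L2_norm M (A f) \<le> C0 * L2_norm M f"
    using bl unfolding L2_bounded_linear_def by blast
  define C where "C = max C0 0"
  have C: "L2_norm M (A f) \<le> C * L2_norm M f" if "f \<in> L2 M" for f
    using C0[OF that] mult_right_mono[of C0 C "L2_norm M f"] by (simp add: C_def)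
  have Bb: "L2_norm M (B p) \<le> C * L2_norm M p" if p: "p \<in> L2 M" for p
  proof (cases "L2_norm M (B p) = 0")
    case True
    then show ?thesis by (simp add: C_def)
  next
    case False
    have "(L2_norm M (B p))\<^sup>2 \<le> C * L2_norm M (B p) * L2_norm M p"
      using L2_norm_adjoint_sq[OF p] mult_right_mono[OF C[OF L2_adjoint_mem[OF p]], of "L2_norm M p"]
      by simp
    then have "L2_norm M (B p) * L2_norm M (B p) \<le> L2_norm M (B p) * (C * L2_norm M p)"
      by (simp add: power2_eq_square mult_ac)
    moreover have "0 < L2_norm M (B p)"
      using False L2_norm_nonneg[of M "B p"] by linarith
    ultimately show ?thesis by simp
  qed
  have "L2_norm M (A (B p)) \<le> (C * C) * L2_norm M p" if p: "p \<in> L2 M" for p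
  proof -
    have "L2_norm M (A (B p)) \<le> C * L2_norm M (B p)"
      using C p L2_adjoint_mem by blast
    also have "\<dots> \<le> C * (C * L2_norm M p)"
      by (rule mult_left_mono[OF Bb[OF p]]) (simp add: C_def)
    finally show ?thesis by (simp add: mult.assoc)
  qed
  then show ?thesis by (rule that)
qed

lemma L2_norm_comp_adjoint_scale:
  assumes p: "p \<in> L2 M"
  shows "L2_norm M (A (B (\<lambda>x. c * p x))) = \<bar>c\<bar> * L2_norm M (A (B p))"
proof -
  let ?q = "\<lambda>x. c * p x"
  have q: "?q \<in> L2 M" using p by simp
  note mem = p q L2_operator_mem L2_adjoint_mem
  have B_scale: "L2_inner M f (B ?q) = c * L2_inner M f (B p)" if "f \<in> L2 M" for f
    using that p q by (simp flip: L2_adjoint_eq)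
  have A_scale: "L2_inner M (A (B ?q)) g = c * L2_inner M (A (B p)) g" if g: "g \<in> L2 M" for g
    using g p q B_scale[of "B g"]
    by (simp add: L2_adjoint_eq mem L2_inner_commute[of M _ "B g"])
  have "L2_inner M (A (B ?q)) (A (B ?q)) = c * L2_inner M (A (B p)) (A (B ?q))"
    by (rule A_scale) (simp add: mem)
  also have "\<dots> = c * (c * L2_inner M (A (B p)) (A (B p)))"
    using A_scale[of "A (B p)"] L2_inner_commute[of M "A (B p)" "A (B ?q)"] by (simp add: mem)
  finally have "L2_inner M (A (B ?q)) (A (B ?q)) = c\<^sup>2 * L2_inner M (A (B p)) (A (B p))"
    by (simp only: power2_eq_square mult.assoc)
  then show ?thesis
    by (simp only: L2_norm_eq_sqrt real_sqrt_mult real_sqrt_abs)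
qed

lemma
  shows L2_onorm_comp_adjoint_nonneg: "0 \<le> L2_onorm M (A \<circ> B)"
    and L2_onorm_comp_adjoint_bound:
      "p \<in> L2 M \<Longrightarrow> L2_norm M (A (B p)) \<le> L2_onorm M (A \<circ> B) * L2_norm M p"
proof -
  obtain C where C: "\<And>p. p \<in> L2 M \<Longrightarrow> L2_norm M (A (B p)) \<le> C * L2_norm M p"
    using L2_comp_adjoint_bounded by blast
  have "L2_norm M ((A \<circ> B) f) \<le> \<bar>C\<bar>" if "f \<in> L2 M" "L2_norm M f \<le> 1" for f
  proof -
    have "C * L2_norm M f \<le> \<bar>C\<bar> * L2_norm M f"
      by (rule mult_right_mono) auto
    also have "\<dots> \<le> \<bar>C\<bar>"
      using that(2) by (simp add: mult_left_le)
    finally show ?thesis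
      using C[OF that(1)] by simp
  qed
  then have bdd: "bdd_above ((\<lambda>f. L2_norm M ((A \<circ> B) f)) ` {f \<in> L2 M. L2_norm M f \<le> 1})"
    by (intro bdd_aboveI2[where M = "\<bar>C\<bar>"]) auto
  have unit: "L2_norm M (A (B f)) \<le> L2_onorm M (A \<circ> B)" if "f \<in> L2 M" "L2_norm M f \<le> 1" for f
    using cSUP_upper[OF _ bdd, of f] that by (simp add: L2_onorm_def)
  have "L2_norm M (A (B (\<lambda>x. 0))) \<le> L2_onorm M (A \<circ> B)"
    by (rule unit) (simp_all add: L2_norm_def)
  then show "0 \<le> L2_onorm M (A \<circ> B)"
    using L2_norm_nonneg order_trans by blast
  show "L2_norm M (A (B p)) \<le> L2_onorm M (A \<circ> B) * L2_norm M p" if p: "p \<in> L2 M"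
  proof (cases "L2_norm M p = 0")
    case True
    then show ?thesis using C[OF p] by simp
  next
    case False
    define c where "c = 1 / L2_norm M p"
    have pos: "0 < L2_norm M p"
      using False L2_norm_nonneg[of M p] by linarith
    have "L2_norm M (\<lambda>x. c * p x) = 1"
      unfolding L2_norm_scale using pos by (simp add: c_def)
    then have "L2_norm M (A (B (\<lambda>x. c * p x))) \<le> L2_onorm M (A \<circ> B)"
      using p by (intro unit) auto
    then show ?thesis
      unfolding L2_norm_comp_adjoint_scale[OF p] using pos by (simp add: c_def field_simps)
  qed
qed

text \<open>
  Since \<open>\<parallel>B p\<parallel>\<^sup>2 = \<langle>A (B p), p\<rangle>\<close>, the norm of \<open>A \<circ> B\<close> bounds the square of the norm of
  \<open>B\<close>, and so that of \<open>A\<close>.  In this way a step size condition that mentions only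
  \<open>A \<circ> B\<close> controls the cross terms \<open>\<langle>A f, p\<rangle>\<close>.
\<close>

lemma L2_inner_operator_bound:
  assumes f: "f \<in> L2 M" and p: "p \<in> L2 M"
  shows "\<bar>L2_inner M (A f) p\<bar> \<le> sqrt (L2_onorm M (A \<circ> B)) * (L2_norm M f * L2_norm M p)"
proof -
  have "(L2_norm M (B p))\<^sup>2 \<le> L2_norm M (A (B p)) * L2_norm M p"
    by (rule L2_norm_adjoint_sq[OF p])
  also have "\<dots> \<le> L2_onorm M (A \<circ> B) * (L2_norm M p)\<^sup>2"
    using mult_right_mono[OF L2_onorm_comp_adjoint_bound[OF p], of "L2_norm M p"]
    by (simp add: power2_eq_square mult_ac)
  finally have "sqrt ((L2_norm M (B p))\<^sup>2) \<le> sqrt (L2_onorm M (A \<circ> B) * (L2_norm M p)\<^sup>2)"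
    by (rule real_sqrt_le_mono)
  then have B: "L2_norm M (B p) \<le> sqrt (L2_onorm M (A \<circ> B)) * L2_norm M p"
    by (simp add: real_sqrt_mult)
  have "\<bar>L2_inner M (A f) p\<bar> \<le> L2_norm M f * L2_norm M (B p)"
    using L2_Cauchy_Schwarz[OF f L2_adjoint_mem[OF p]] f p by (simp add: L2_adjoint_eq)
  also have "\<dots> \<le> L2_norm M f * (sqrt (L2_onorm M (A \<circ> B)) * L2_norm M p)"
    by (rule mult_left_mono[OF B]) simp
  finally show ?thesis by (simp add: mult_ac)
qed

text \<open>
  The operator is linear only up to null sets.  Passing to the adjoint turns linearity in the
  argument of \<open>A\<close> into exact linearity of the inner product in its left argument.
\<close>

lemma L2_inner_operator_add:
  assumes "f \<in> L2 M" "g \<in> L2 M" "q \<in> L2 M"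
  shows "L2_inner M (A (\<lambda>x. f x + g x)) q = L2_inner M (A f) q + L2_inner M (A g) q"
  using assms by (simp add: L2_adjoint_eq L2_adjoint_mem)

lemma L2_inner_operator_diff:
  assumes "f \<in> L2 M" "g \<in> L2 M" "q \<in> L2 M"
  shows "L2_inner M (A (\<lambda>x. f x - g x)) q = L2_inner M (A f) q - L2_inner M (A g) q"
  using assms by (simp add: L2_adjoint_eq L2_adjoint_mem)

lemma L2_inner_operator_scale:
  assumes "f \<in> L2 M" "q \<in> L2 M"
  shows "L2_inner M (A (\<lambda>x. c * f x)) q = c * L2_inner M (A f) q"
  using assms by (simp add: L2_adjoint_eq L2_adjoint_mem)

lemma L2_inner_operator_cong_AE:
  assumes "f \<in> L2 M" "f' \<in> L2 M" "q \<in> L2 M" "q' \<in> L2 M"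
    and "AE x in M. f x = f' x" "AE x in M. q x = q' x"
  shows "L2_inner M (A f) q = L2_inner M (A f') q'"
proof -
  have "L2_inner M (A f) q = L2_inner M (A f') q"
    using assms by (simp add: L2_adjoint_eq, intro L2_inner_cong_AE) (auto simp: L2_adjoint_mem)
  also have "\<dots> = L2_inner M (A f') q'"
    by (rule L2_inner_cong_AE) (use assms in \<open>auto simp: L2_operator_mem\<close>)
  finally show ?thesis .
qed

end

section \<open>Minimizers of sparse quadratic energies\<close>

text \<open>
  Every minimization of the algorithm and of the saddle point problem is of this form, with
  \<open>\<beta> = 0\<close> for the dual variable: expanding the square of a proximal term changes only
  \<open>\<mu>\<close> and \<open>l\<close>, up to a constant.
\<close>

definition energy :: "'a measure \<Rightarrow> real \<Rightarrow> real \<Rightarrow> ('a \<Rightarrow> real) \<Rightarrow> ('a \<Rightarrow> real) \<Rightarrow> real" where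
  "energy M \<mu> \<beta> l w = \<mu> / 2 * L2_inner M w w + \<beta> * (LINT x|M. \<bar>w x\<bar>) + L2_inner M w l"

text \<open>
  First-order optimality, obtained by comparing \<open>w\<close> with \<open>w + t (y - w)\<close> for small \<open>t > 0\<close>:
  the nonsmooth term is bounded by convexity, the quadratic one is expanded, and the
  remainder of order \<open>t\<^sup>2\<close> is negligible after division by \<open>t\<close>.
\<close>

lemma (in finite_measure) energy_minimizer_variational_inequality:
  assumes w: "w \<in> L2 M" and y: "y \<in> L2 M" and l: "l \<in> L2 M" and "\<beta> \<ge> 0"
    and min: "\<And>z. z \<in> L2 M \<Longrightarrow> energy M \<mu> \<beta> l w \<le> energy M \<mu> \<beta> l z"
  shows "0 \<le> \<beta> * ((LINT x|M. \<bar>y x\<bar>) - (LINT x|M. \<bar>w x\<bar>))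
             + L2_inner M (\<lambda>x. y x - w x) (\<lambda>x. \<mu> * w x + l x)" (is "0 \<le> ?D")
proof -
  define N where "N = L2_inner M (\<lambda>x. y x - w x) (\<lambda>x. y x - w x)"
  have small: "0 \<le> ?D + t * (\<mu> / 2 * N)" if t: "0 < t" "t \<le> 1" for t
  proof -
    define z where "z = (\<lambda>x. w x + t * (y x - w x))"
    have z: "z \<in> L2 M" using w y by (simp add: z_def)
    have "(LINT x|M. \<bar>z x\<bar>) \<le> (LINT x|M. (1 - t) * \<bar>w x\<bar> + t * \<bar>y x\<bar>)"
    proof (rule integral_mono)
      fix x
      have "z x = (1 - t) * w x + t * y x" by (simp add: z_def algebra_simps)
      also have "\<bar>\<dots>\<bar> \<le> \<bar>(1 - t) * w x\<bar> + \<bar>t * y x\<bar>" by (rule abs_triangle_ineq)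
      finally show "\<bar>z x\<bar> \<le> (1 - t) * \<bar>w x\<bar> + t * \<bar>y x\<bar>"
        using t by (simp add: abs_mult)
    qed (use L2_integrable_abs w y z in auto)
    also have "\<dots> = (1 - t) * (LINT x|M. \<bar>w x\<bar>) + t * (LINT x|M. \<bar>y x\<bar>)"
      using L2_integrable_abs w y by simp
    finally have "\<beta> * (LINT x|M. \<bar>z x\<bar>) \<le> \<beta> * ((1 - t) * (LINT x|M. \<bar>w x\<bar>) + t * (LINT x|M. \<bar>y x\<bar>))"
      using \<open>\<beta> \<ge> 0\<close> by (rule mult_left_mono)
    then have "0 \<le> t * (?D + t * (\<mu> / 2 * N))"
      using min[OF z] w y l
      by (simp add: energy_def z_def N_def L2_inner_commute[of M y w] algebra_simps
          power2_eq_square)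
    then show ?thesis
      using t by (simp add: zero_le_mult_iff)
  qed
  have "((\<lambda>t. ?D + t * (\<mu> / 2 * N)) \<longlongrightarrow> ?D + 0 * (\<mu> / 2 * N)) (at_right 0)"
    by (intro tendsto_intros)
  moreover have "\<forall>\<^sub>F t in at_right (0::real). 0 \<le> ?D + t * (\<mu> / 2 * N)"
    using eventually_at_right_real[OF zero_less_one] by eventually_elim (rule small, auto)
  ultimately show ?thesis
    by (auto intro: tendsto_lowerbound)
qed

text \<open>
  Testing the variational inequality of each of the two minimizers with the other one and
  adding the results cancels the nonsmooth terms and leaves the strong monotonicity of the
  quadratic part.
\<close>

lemma (in finite_measure) proximal_step_monotone:
  assumes mem: "w \<in> L2 M" "w' \<in> L2 M" "z \<in> L2 M" "l \<in> L2 M" "l' \<in> L2 M" and "\<beta> \<ge> 0"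
    and prox: "\<And>y. y \<in> L2 M \<Longrightarrow>
      energy M \<mu> \<beta> l w + \<eta> / 2 * (L2_norm M (\<lambda>x. w x - z x))\<^sup>2
        \<le> energy M \<mu> \<beta> l y + \<eta> / 2 * (L2_norm M (\<lambda>x. y x - z x))\<^sup>2"
    and min: "\<And>y. y \<in> L2 M \<Longrightarrow> energy M \<mu> \<beta> l' w' \<le> energy M \<mu> \<beta> l' y"
  shows "L2_inner M (\<lambda>x. w x - w' x) (\<lambda>x. l x - l' x)
         + \<eta> * L2_inner M (\<lambda>x. w x - w' x) (\<lambda>x. w x - z x)
         \<le> - \<mu> * (L2_norm M (\<lambda>x. w x - w' x))\<^sup>2"
proof -
  let ?l = "\<lambda>x. l x - \<eta> * z x"
  have shift: "energy M \<mu> \<beta> l y + \<eta> / 2 * (L2_norm M (\<lambda>x. y x - z x))\<^sup>2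
      = energy M (\<mu> + \<eta>) \<beta> ?l y + \<eta> / 2 * L2_inner M z z" if "y \<in> L2 M" for y
    using that mem by (simp add: energy_def L2_norm_power2 L2_inner_commute[of M z y] field_simps)
  have "energy M (\<mu> + \<eta>) \<beta> ?l w \<le> energy M (\<mu> + \<eta>) \<beta> ?l y" if "y \<in> L2 M" for y
    using prox[OF that] shift[OF that] shift[OF mem(1)] by simp
  then have "0 \<le> \<beta> * ((LINT x|M. \<bar>w' x\<bar>) - (LINT x|M. \<bar>w x\<bar>))
      + L2_inner M (\<lambda>x. w' x - w x) (\<lambda>x. (\<mu> + \<eta>) * w x + ?l x)"
    using mem \<open>\<beta> \<ge> 0\<close> by (intro energy_minimizer_variational_inequality) auto
  moreover have "0 \<le> \<beta> * ((LINT x|M. \<bar>w x\<bar>) - (LINT x|M. \<bar>w' x\<bar>))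
      + L2_inner M (\<lambda>x. w x - w' x) (\<lambda>x. \<mu> * w' x + l' x)"
    using mem \<open>\<beta> \<ge> 0\<close> min by (intro energy_minimizer_variational_inequality) auto
  ultimately show ?thesis
    using mem by (simp add: L2_norm_power2 L2_inner_commute[of M w' w] algebra_simps)
qed

section \<open>The Lyapunov functional\<close>

lemma weighted_Young_inequality:
  fixes a b m x y :: real
  assumes "0 \<le> a" "0 \<le> b" "m\<^sup>2 \<le> a * b" "0 \<le> x" "0 \<le> y"
  shows "2 * m * (x * y) \<le> a * x\<^sup>2 + b * y\<^sup>2"
proof -
  have "m \<le> sqrt (a * b)"
    using assms(3) by (rule real_le_rsqrt)
  then have "2 * m * (x * y) \<le> 2 * (sqrt a * sqrt b) * (x * y)"
    using assms(4,5) by (intro mult_right_mono) (auto simp: real_sqrt_mult)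
  also have "\<dots> = 2 * (sqrt a * x) * (sqrt b * y)"
    by simp
  also have "\<dots> \<le> (sqrt a * x)\<^sup>2 + (sqrt b * y)\<^sup>2"
    by (rule sum_squares_bound)
  finally show ?thesis
    using assms(1,2) by (simp add: power_mult_distrib)
qed

text \<open>
  What the admissible range of \<open>\<rho>\<close> and \<open>\<sigma>\<close> is good for: the relation \<open>\<theta> \<sigma> = \<rho>\<close>
  symmetrizes the block operator behind \<open>lyapunov\<close>, and the quadratic inequality is the discriminant
  condition in \<open>correction_form_coercive\<close>.
\<close>

lemma relaxation_parameters:
  fixes \<theta> \<rho> \<sigma> :: real
  assumes th: "0 < \<theta>" "\<theta> \<le> 1"
    and one: "\<theta> = 1 \<Longrightarrow> \<rho> = \<sigma> \<and> 0 < \<rho> \<and> \<rho> < 2"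
    and less: "\<theta> < 1 \<Longrightarrow> 0 < \<rho> \<and> \<rho> \<le> 1 + \<theta> - sqrt (1 - \<theta>) \<and> \<sigma> = \<rho> / \<theta>"
  shows "0 < \<rho>" "\<rho> < 2" "\<theta> * \<sigma> = \<rho>" "\<sigma> < 2"
    and "(1 + \<theta> - \<rho>)\<^sup>2 \<le> (2 - \<rho>) * (2 - \<sigma>)"
    and "\<rho> \<le> 1 + \<theta>"
proof -
  have "0 < \<rho> \<and> \<rho> < 2 \<and> \<theta> * \<sigma> = \<rho> \<and> \<sigma> < 2
      \<and> (1 + \<theta> - \<rho>)\<^sup>2 \<le> (2 - \<rho>) * (2 - \<sigma>) \<and> \<rho> \<le> 1 + \<theta>"
  proof (cases "\<theta> = 1")
    case True
    then show ?thesis using one by (simp add: power2_eq_square)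
  next
    case False
    then have lt: "\<theta> < 1" using th by simp
    define q where "q = sqrt (1 - \<theta>)"
    have q: "0 < q" "q < 1" "q\<^sup>2 = 1 - \<theta>"
      using lt th by (auto simp: q_def)
    have rho: "0 < \<rho>" "\<rho> \<le> 1 + \<theta> - q" "\<sigma> = \<rho> / \<theta>"
      using less[OF lt] by (auto simp: q_def)
    have ts: "\<theta> * \<sigma> = \<rho>" using rho th by simp
    have "q * q < q" using q by simp
    then have "\<rho> < 2 * \<theta>"
      using rho(2) q(3) by (simp add: power2_eq_square)
    then have "\<theta> * \<sigma> < \<theta> * 2" "\<rho> < 2"
      using th ts by auto
    then have "\<sigma> < 2"
      using th by (simp only: mult_less_cancel_left_pos)
    (* With z = 1 + \<theta> - \<rho> the claim reads (1 - \<theta>)\<^sup>2 \<le> (1 - \<theta>) z\<^sup>2 after multiplication by \<theta>. *)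
    have "1 - \<theta> \<le> (1 + \<theta> - \<rho>)\<^sup>2"
      using power_mono[of q "1 + \<theta> - \<rho>" 2] rho(2) q by simp
    then have "(1 - \<theta>) * (1 - \<theta>) \<le> (1 - \<theta>) * (1 + \<theta> - \<rho>)\<^sup>2"
      using lt by (intro mult_left_mono) auto
    moreover have "\<theta> * ((2 - \<rho>) * (2 - \<sigma>)) = (2 - \<rho>) * (2 * \<theta> - \<rho>)"
      by (simp add: algebra_simps flip: ts)
    ultimately have "\<theta> * (1 + \<theta> - \<rho>)\<^sup>2 \<le> \<theta> * ((2 - \<rho>) * (2 - \<sigma>))"
      by (simp add: power2_eq_square algebra_simps)
    then have "(1 + \<theta> - \<rho>)\<^sup>2 \<le> (2 - \<rho>) * (2 - \<sigma>)"
      using th by simp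
    then show ?thesis
      using rho q ts \<open>\<sigma> < 2\<close> \<open>\<rho> < 2\<close> by simp
  qed
  then show "0 < \<rho>" "\<rho> < 2" "\<theta> * \<sigma> = \<rho>" "\<sigma> < 2"
    "(1 + \<theta> - \<rho>)\<^sup>2 \<le> (2 - \<rho>) * (2 - \<sigma>)" "\<rho> \<le> 1 + \<theta>"
    by auto
qed

lemma dissipation_tendsto_zero:
  fixes V D :: "nat \<Rightarrow> real"
  assumes V: "\<And>k. 0 \<le> V k" and D: "\<And>k. 0 \<le> D k" and dec: "\<And>k. D k \<le> V k - V (Suc k)"
  shows "D \<longlonglongrightarrow> 0"
proof -
  have "decseq V"
    by (rule decseq_SucI) (use D dec in \<open>smt (verit)\<close>)
  then obtain l where l: "V \<longlonglongrightarrow> l"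
    using decseq_convergent[of V 0] V by blast
  have "(\<lambda>k. V k - V (Suc k)) \<longlonglongrightarrow> l - l"
    by (intro tendsto_diff l LIMSEQ_Suc)
  then have "(\<lambda>k. V k - V (Suc k)) \<longlonglongrightarrow> 0" by simp
  then show ?thesis
    by (intro tendsto_sandwich[OF _ _ tendsto_const, of 0 D sequentially "\<lambda>k. V k - V (Suc k)"])
      (use D dec in auto)
qed

text \<open>
  For \<open>\<theta> \<sigma> = \<rho>\<close> this is \<open>\<rho>\<close> times the quadratic form at \<open>(x, y)\<close> of the block operator
  \<open>Q D\<^sup>-\<^sup>1\<close>, where \<open>Q\<close> has the rows \<open>(1 / r, - A\<^sup>*)\<close> and \<open>(- \<theta> A, 1 / s)\<close> and collects
  the proximal and coupling terms of the prediction, and \<open>D = diag(\<rho>, \<sigma>)\<close> is the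
  relaxation.
\<close>

definition lyapunov ::
  "'a measure \<Rightarrow> (('a \<Rightarrow> real) \<Rightarrow> ('a \<Rightarrow> real)) \<Rightarrow> real \<Rightarrow> real \<Rightarrow> real
     \<Rightarrow> ('a \<Rightarrow> real) \<Rightarrow> ('a \<Rightarrow> real) \<Rightarrow> real" where
  "lyapunov M A r s \<theta> x y =
     L2_inner M x x / r - 2 * \<theta> * L2_inner M (A x) y + \<theta> / s * L2_inner M y y"

lemma lyapunov_nonneg:
  assumes bl: "L2_bounded_linear M A" and adj: "L2_adjoint M A B"
    and rs: "0 < r" "0 < s" "r * s * L2_onorm M (A \<circ> B) \<le> 1" and th: "0 \<le> \<theta>" "\<theta> \<le> 1"
    and x: "x \<in> L2 M" and y: "y \<in> L2 M"
  shows "0 \<le> lyapunov M A r s \<theta> x y"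
proof -
  define K where "K = L2_onorm M (A \<circ> B)"
  have K: "0 \<le> K"
    unfolding K_def by (rule L2_onorm_comp_adjoint_nonneg[OF bl adj])
  have "\<theta> * (\<theta> * K) \<le> \<theta> * (1 * (1 / (r * s)))"
    using th rs K by (intro mult_left_mono mult_mono) (auto simp: K_def field_simps)
  then have "(\<theta> * sqrt K)\<^sup>2 \<le> 1 / r * (\<theta> / s)"
    using K by (simp add: power2_eq_square power_mult_distrib mult_ac)
  then have "2 * (\<theta> * sqrt K) * (L2_norm M x * L2_norm M y)
      \<le> 1 / r * (L2_norm M x)\<^sup>2 + \<theta> / s * (L2_norm M y)\<^sup>2"
    using rs th by (intro weighted_Young_inequality) auto
  moreover have "2 * \<theta> * L2_inner M (A x) y \<le> 2 * \<theta> * (sqrt K * (L2_norm M x * L2_norm M y))"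
    using L2_inner_operator_bound[OF bl adj x y] th
    by (intro mult_left_mono) (auto simp: K_def)
  ultimately show ?thesis
    by (simp add: lyapunov_def L2_norm_power2 mult_ac)
qed

text \<open>
  The discriminant condition on \<open>z\<close> alone makes the right-hand side nonnegative when
  \<open>r s \<parallel>A B\<parallel> = 1\<close>; a strict inequality there leaves the positive factor on the left.
\<close>

lemma correction_form_coercive:
  assumes bl: "L2_bounded_linear M A" and adj: "L2_adjoint M A B"
    and rs: "0 < r" "0 < s"
    and par: "\<rho> < 2" "\<sigma> < 2" "0 \<le> z" "z\<^sup>2 \<le> (2 - \<rho>) * (2 - \<sigma>)"
    and a: "a \<in> L2 M" and b: "b \<in> L2 M"
  shows "(1 - sqrt (r * s * L2_onorm M (A \<circ> B)))
           * ((2 - \<rho>) / r * L2_inner M a a + (2 - \<sigma>) / s * L2_inner M b b)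
         \<le> (2 - \<rho>) / r * L2_inner M a a - 2 * z * L2_inner M (A a) b
           + (2 - \<sigma>) / s * L2_inner M b b"
proof -
  define K where "K = L2_onorm M (A \<circ> B)"
  define q where "q = sqrt (r * s * K)"
  have K: "0 \<le> K"
    unfolding K_def by (rule L2_onorm_comp_adjoint_nonneg[OF bl adj])
  have q: "0 \<le> q" "q\<^sup>2 = r * s * K"
    using K rs by (auto simp: q_def)
  have "(q * ((2 - \<rho>) / r)) * (q * ((2 - \<sigma>) / s)) = q\<^sup>2 * ((2 - \<rho>) * (2 - \<sigma>)) / (r * s)"
    by (simp add: power2_eq_square)
  also have "\<dots> = K * ((2 - \<rho>) * (2 - \<sigma>))"
    using rs by (simp add: q)
  finally have "(z * sqrt K)\<^sup>2 \<le> (q * ((2 - \<rho>) / r)) * (q * ((2 - \<sigma>) / s))"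
    using mult_left_mono[OF par(4) K] K by (simp add: power_mult_distrib mult_ac)
  then have "2 * (z * sqrt K) * (L2_norm M a * L2_norm M b)
      \<le> (q * ((2 - \<rho>) / r)) * (L2_norm M a)\<^sup>2 + (q * ((2 - \<sigma>) / s)) * (L2_norm M b)\<^sup>2"
    using q rs par by (intro weighted_Young_inequality) auto
  also have "\<dots> = q * ((2 - \<rho>) / r * L2_inner M a a + (2 - \<sigma>) / s * L2_inner M b b)"
    unfolding L2_norm_power2 by argo
  finally have young: "2 * (z * sqrt K) * (L2_norm M a * L2_norm M b) \<le> \<dots>" .
  have "2 * z * L2_inner M (A a) b \<le> 2 * z * (sqrt K * (L2_norm M a * L2_norm M b))"
    using L2_inner_operator_bound[OF bl adj a b] par
    by (intro mult_left_mono) (auto simp: K_def)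
  also have "\<dots> = 2 * (z * sqrt K) * (L2_norm M a * L2_norm M b)"
    by simp
  also note young
  finally have "(1 - q) * ((2 - \<rho>) / r * L2_inner M a a + (2 - \<sigma>) / s * L2_inner M b b)
      \<le> (2 - \<rho>) / r * L2_inner M a a + (2 - \<sigma>) / s * L2_inner M b b
        - 2 * z * L2_inner M (A a) b"
    by (simp only: left_diff_distrib mult_1_left)
  then show ?thesis
    unfolding q_def K_def by linarith
qed

text \<open>
  Here \<open>(e, f)\<close> stands for the error of the predicted pair and
  \<open>(a, b)\<close> for the correction, so that \<open>(e + a, f + b)\<close> belongs to the current iterate and
  the relaxed step multiplies \<open>a\<close> by \<open>1 - \<rho>\<close> and \<open>b\<close> by \<open>1 - \<sigma>\<close>.  The terms mixing
  \<open>(e, f)\<close> with \<open>(a, b)\<close> are those of the optimality conditions of the prediction.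
\<close>

lemma lyapunov_step_identity:
  assumes bl: "L2_bounded_linear M A" and adj: "L2_adjoint M A B"
    and par: "\<theta> * \<sigma> = \<rho>"
    and mem: "e \<in> L2 M" "f \<in> L2 M" "a \<in> L2 M" "b \<in> L2 M"
  shows "lyapunov M A r s \<theta> (\<lambda>x. e x + a x) (\<lambda>x. f x + b x)
           - lyapunov M A r s \<theta> (\<lambda>x. e x + (1 - \<rho>) * a x) (\<lambda>x. f x + (1 - \<sigma>) * b x)
         = \<rho> * (2 * (L2_inner M e a / r + L2_inner M f b / s
                      - L2_inner M (A e) b - \<theta> * L2_inner M (A a) f)
                + ((2 - \<rho>) / r * L2_inner M a a - 2 * (1 + \<theta> - \<rho>) * L2_inner M (A a) b
                   + (2 - \<sigma>) / s * L2_inner M b b))"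
proof -
  have rho: "\<rho> = \<theta> * \<sigma>" using par by simp
  show ?thesis
    using mem
    by (simp add: lyapunov_def L2_inner_operator_add[OF bl adj] L2_inner_operator_scale[OF bl adj]
        L2_operator_mem[OF bl adj] L2_inner_commute[of M a e] L2_inner_commute[of M b f])
      (simp add: rho divide_inverse algebra_simps power2_eq_square)
qed

lemma lyapunov_cong_AE:
  assumes bl: "L2_bounded_linear M A" and adj: "L2_adjoint M A B"
    and "x \<in> L2 M" "x' \<in> L2 M" "y \<in> L2 M" "y' \<in> L2 M"
    and "AE t in M. x t = x' t" "AE t in M. y t = y' t"
  shows "lyapunov M A r s \<theta> x y = lyapunov M A r s \<theta> x' y'"
proof -
  have "L2_inner M x x = L2_inner M x' x'" "L2_inner M y y = L2_inner M y' y'"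
    by (rule L2_inner_cong_AE; fact)+
  moreover have "L2_inner M (A x) y = L2_inner M (A x') y'"
    by (rule L2_inner_operator_cong_AE[OF bl adj]; fact)
  ultimately show ?thesis
    by (simp add: lyapunov_def)
qed

section \<open>The primal-dual iteration\<close>

lemma primal_objective_eq_energy:
  assumes "L2_bounded_linear M A" "L2_adjoint M A B" "w \<in> L2 M" "q \<in> L2 M"
  shows "g_fun M \<tau> \<beta> w + (LINT x|M. q x * A w x) = energy M \<tau> \<beta> (B q) w"
proof -
  have "(LINT x|M. q x * A w x) = L2_inner M w (B q)"
    using assms by (simp flip: L2_inner_real add: L2_inner_commute[of M q] L2_adjoint_eq)
  then show ?thesis
    by (simp add: g_fun_def energy_def L2_inner_real power2_eq_square)
qed

lemma dual_objective_eq_energy: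
  assumes "uT \<in> L2 M" "h \<in> L2 M" "q \<in> L2 M"
  shows "(LINT x|M. q x * h x) - f_conj M uT q = - energy M 1 0 (\<lambda>x. uT x - h x) q"
  using assms
  by (simp add: f_conj_def energy_def power2_eq_square flip: L2_inner_real)

lemma L2_norm_add_power2_le:
  fixes e a :: "'a \<Rightarrow> real"
  assumes "e \<in> L2 M" "a \<in> L2 M"
  shows "(L2_norm M (\<lambda>x. e x + a x))\<^sup>2 \<le> 2 * (L2_inner M e e + L2_inner M a a)"
proof -
  have "0 \<le> L2_inner M (\<lambda>x. e x - a x) (\<lambda>x. e x - a x)"
    by simp
  then show ?thesis
    using assms by (simp add: L2_norm_power2 L2_inner_commute[of M a e])
qed

text \<open>
  Adding the optimality conditions of the two prediction steps to those of the saddle point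
  bounds the cross terms of \<open>lyapunov_step_identity\<close> from below by
  \<open>\<tau> \<parallel>e\<parallel>\<^sup>2 + \<parallel>f\<parallel>\<^sup>2\<close>: both objectives are strongly convex, and this is where strong
  convergence comes from.
\<close>

lemma (in finite_measure) prediction_monotone:
  fixes x y ut pt us ps :: "'a \<Rightarrow> real"
  assumes bl: "L2_bounded_linear M A" and adj: "L2_adjoint M A B"
    and uT: "uT \<in> L2 M" and beta: "\<beta> \<ge> 0"
    and xy: "x \<in> L2 M" "y \<in> L2 M"
    and ut: "is_arg_min (\<lambda>w. g_fun M \<tau> \<beta> w + (LINT t|M. y t * A w t)
               + 1 / (2 * r) * (L2_norm M (\<lambda>t. w t - x t))\<^sup>2) (\<lambda>w. w \<in> L2 M) ut"
    and ub: "ub = (\<lambda>t. ut t + \<theta> * (ut t - x t))"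
    and pt: "is_arg_max (\<lambda>q. (LINT t|M. q t * A ub t) - f_conj M uT q
               - 1 / (2 * s) * (L2_norm M (\<lambda>t. q t - y t))\<^sup>2) (\<lambda>q. q \<in> L2 M) pt"
    and saddle: "saddle_point M (lagrangian M \<tau> \<beta> uT A) us ps"
  defines "e \<equiv> \<lambda>t. ut t - us t" and "f \<equiv> \<lambda>t. pt t - ps t"
    and "a \<equiv> \<lambda>t. x t - ut t" and "b \<equiv> \<lambda>t. y t - pt t"
  shows "\<tau> * L2_inner M e e + L2_inner M f f
    \<le> L2_inner M e a / r + L2_inner M f b / s - L2_inner M (A e) b - \<theta> * L2_inner M (A a) f"
proof -
  have star: "us \<in> L2 M" "ps \<in> L2 M"
    and star_max: "\<And>q. q \<in> L2 M \<Longrightarrow> lagrangian M \<tau> \<beta> uT A us q \<le> lagrangian M \<tau> \<beta> uT A us ps"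
    and star_min: "\<And>w. w \<in> L2 M \<Longrightarrow> lagrangian M \<tau> \<beta> uT A us ps \<le> lagrangian M \<tau> \<beta> uT A w ps"
    using saddle by (auto simp: saddle_point_def)
  have tilde: "ut \<in> L2 M" "pt \<in> L2 M"
    using ut pt by (auto simp: is_arg_min_def is_arg_max_def)
  have ub_mem: "ub \<in> L2 M"
    using tilde xy by (simp add: ub)
  note A_mem = L2_operator_mem[OF bl adj] and B_mem = L2_adjoint_mem[OF bl adj]
  note mem = xy star tilde ub_mem uT A_mem B_mem
  note primal = primal_objective_eq_energy[OF bl adj]
  note expand = L2_inner_operator_add[OF bl adj] L2_inner_operator_diff[OF bl adj]
    L2_inner_operator_scale[OF bl adj]

  have "energy M \<tau> \<beta> (B y) ut + 1 / r / 2 * (L2_norm M (\<lambda>t. ut t - x t))\<^sup>2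
      \<le> energy M \<tau> \<beta> (B y) w + 1 / r / 2 * (L2_norm M (\<lambda>t. w t - x t))\<^sup>2" if "w \<in> L2 M" for w
    using ut that xy tilde by (simp add: is_arg_min_linorder primal mult.commute[of r])
  moreover have "energy M \<tau> \<beta> (B ps) us \<le> energy M \<tau> \<beta> (B ps) w" if "w \<in> L2 M" for w
    using star_min[OF that] that star by (simp add: lagrangian_def primal)
  ultimately have "L2_inner M e (\<lambda>t. B y t - B ps t) + 1 / r * L2_inner M e (\<lambda>t. ut t - x t)
      \<le> - \<tau> * (L2_norm M e)\<^sup>2"
    unfolding e_def using mem beta by (intro proximal_step_monotone) auto
  moreover have "L2_inner M e (\<lambda>t. B y t - B ps t) = L2_inner M (A e) f + L2_inner M (A e) b"
    using mem by (simp add: e_def f_def b_def expand flip: L2_adjoint_eq[OF bl adj])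
  moreover have "L2_inner M e (\<lambda>t. ut t - x t) = - L2_inner M e a"
    using mem by (simp add: e_def a_def)
  ultimately have P: "L2_inner M (A e) f + L2_inner M (A e) b - L2_inner M e a / r
      \<le> - \<tau> * L2_inner M e e"
    by (simp add: L2_norm_power2)

  have "energy M 1 0 (\<lambda>t. uT t - A ub t) pt + 1 / s / 2 * (L2_norm M (\<lambda>t. pt t - y t))\<^sup>2
      \<le> energy M 1 0 (\<lambda>t. uT t - A ub t) q + 1 / s / 2 * (L2_norm M (\<lambda>t. q t - y t))\<^sup>2"
    if "q \<in> L2 M" for q
  proof -
    have "- energy M 1 0 (\<lambda>t. uT t - A ub t) q - 1 / (2 * s) * (L2_norm M (\<lambda>t. q t - y t))\<^sup>2
      \<le> - energy M 1 0 (\<lambda>t. uT t - A ub t) pt - 1 / (2 * s) * (L2_norm M (\<lambda>t. pt t - y t))\<^sup>2"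
      using pt that mem by (simp add: is_arg_max_linorder dual_objective_eq_energy)
    then show ?thesis by (simp add: mult.commute[of s])
  qed
  moreover have "energy M 1 0 (\<lambda>t. uT t - A us t) ps \<le> energy M 1 0 (\<lambda>t. uT t - A us t) q"
    if "q \<in> L2 M" for q
    using star_max[OF that] dual_objective_eq_energy[OF uT A_mem[OF star(1)] that]
      dual_objective_eq_energy[OF uT A_mem[OF star(1)] star(2)]
    by (simp add: lagrangian_def)
  ultimately have "L2_inner M f (\<lambda>t. (uT t - A ub t) - (uT t - A us t))
      + 1 / s * L2_inner M f (\<lambda>t. pt t - y t) \<le> - 1 * (L2_norm M f)\<^sup>2"
    unfolding f_def using mem by (intro proximal_step_monotone[where \<beta> = 0]) auto
  moreover have "L2_inner M f (\<lambda>t. (uT t - A ub t) - (uT t - A us t))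
      = \<theta> * L2_inner M (A a) f - L2_inner M (A e) f"
  proof -
    have f: "f \<in> L2 M" using mem by (simp add: f_def)
    have "L2_inner M f (\<lambda>t. (uT t - A ub t) - (uT t - A us t))
        = L2_inner M (A us) f - L2_inner M (A ub) f"
      using mem f by (simp add: L2_inner_commute[of M f])
    also have "\<dots> = \<theta> * L2_inner M (A a) f - L2_inner M (A e) f"
      using mem f by (simp add: ub e_def a_def expand algebra_simps)
    finally show ?thesis .
  qed
  moreover have "L2_inner M f (\<lambda>t. pt t - y t) = - L2_inner M f b"
    using mem by (simp add: f_def b_def)
  ultimately have "\<theta> * L2_inner M (A a) f - L2_inner M (A e) f - L2_inner M f b / s
      \<le> - L2_inner M f f"
    by (simp add: L2_norm_power2)
  with P show ?thesis by linarith
qed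

text \<open>
  The decrease controls the prediction error by strong convexity and the correction by
  \<open>correction_form_coercive\<close>; together they dominate the error of the iterate itself.  The
  constant \<open>m\<close> is any common lower bound of the four coefficients involved.
\<close>

lemma (in finite_measure) primal_dual_step_dissipation:
  fixes x y x' y' ut pt us ps :: "'a \<Rightarrow> real"
  assumes bl: "L2_bounded_linear M A" and adj: "L2_adjoint M A B"
    and uT: "uT \<in> L2 M" and beta: "\<beta> \<ge> 0" and rs: "0 < r" "0 < s"
    and par: "0 < \<rho>" "\<rho> < 2" "\<theta> * \<sigma> = \<rho>" "\<sigma> < 2" "(1 + \<theta> - \<rho>)\<^sup>2 \<le> (2 - \<rho>) * (2 - \<sigma>)"
      "\<rho> \<le> 1 + \<theta>"
    and m: "0 \<le> m" "m \<le> 2 * \<tau>" "m \<le> 2"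
      "m \<le> (1 - sqrt (r * s * L2_onorm M (A \<circ> B))) * ((2 - \<rho>) / r)"
      "m \<le> (1 - sqrt (r * s * L2_onorm M (A \<circ> B))) * ((2 - \<sigma>) / s)"
    and mem: "x \<in> L2 M" "y \<in> L2 M" "x' \<in> L2 M" "y' \<in> L2 M"
    and ut: "is_arg_min (\<lambda>w. g_fun M \<tau> \<beta> w + (LINT t|M. y t * A w t)
               + 1 / (2 * r) * (L2_norm M (\<lambda>t. w t - x t))\<^sup>2) (\<lambda>w. w \<in> L2 M) ut"
    and ub: "ub = (\<lambda>t. ut t + \<theta> * (ut t - x t))"
    and pt: "is_arg_max (\<lambda>q. (LINT t|M. q t * A ub t) - f_conj M uT q
               - 1 / (2 * s) * (L2_norm M (\<lambda>t. q t - y t))\<^sup>2) (\<lambda>q. q \<in> L2 M) pt"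
    and x': "AE t in M. x' t = x t - \<rho> * (x t - ut t)"
    and y': "AE t in M. y' t = y t - \<sigma> * (y t - pt t)"
    and saddle: "saddle_point M (lagrangian M \<tau> \<beta> uT A) us ps"
  shows "\<rho> * m / 2 * ((L2_norm M (\<lambda>t. x t - us t))\<^sup>2 + (L2_norm M (\<lambda>t. y t - ps t))\<^sup>2)
    \<le> lyapunov M A r s \<theta> (\<lambda>t. x t - us t) (\<lambda>t. y t - ps t)
      - lyapunov M A r s \<theta> (\<lambda>t. x' t - us t) (\<lambda>t. y' t - ps t)"
proof -
  define e f a b where "e = (\<lambda>t. ut t - us t)" and "f = (\<lambda>t. pt t - ps t)"
    and "a = (\<lambda>t. x t - ut t)" and "b = (\<lambda>t. y t - pt t)"
  have star: "us \<in> L2 M" "ps \<in> L2 M"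
    using saddle by (auto simp: saddle_point_def)
  have tilde: "ut \<in> L2 M" "pt \<in> L2 M"
    using ut pt by (auto simp: is_arg_min_def is_arg_max_def)
  have mem': "e \<in> L2 M" "f \<in> L2 M" "a \<in> L2 M" "b \<in> L2 M"
    using mem star tilde by (auto simp: e_def f_def a_def b_def)
  define g where "g = 1 - sqrt (r * s * L2_onorm M (A \<circ> B))"
  define X where "X = L2_inner M e a / r + L2_inner M f b / s
    - L2_inner M (A e) b - \<theta> * L2_inner M (A a) f"
  define Y where "Y = (2 - \<rho>) / r * L2_inner M a a - 2 * (1 + \<theta> - \<rho>) * L2_inner M (A a) b
    + (2 - \<sigma>) / s * L2_inner M b b"
  have old: "(\<lambda>t. x t - us t) = (\<lambda>t. e t + a t)" "(\<lambda>t. y t - ps t) = (\<lambda>t. f t + b t)"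
    by (auto simp: e_def f_def a_def b_def)
  have "lyapunov M A r s \<theta> (\<lambda>t. x' t - us t) (\<lambda>t. y' t - ps t)
      = lyapunov M A r s \<theta> (\<lambda>t. e t + (1 - \<rho>) * a t) (\<lambda>t. f t + (1 - \<sigma>) * b t)"
  proof (rule lyapunov_cong_AE[OF bl adj])
    show "AE t in M. x' t - us t = e t + (1 - \<rho>) * a t"
      using x' by eventually_elim (simp add: e_def a_def algebra_simps)
    show "AE t in M. y' t - ps t = f t + (1 - \<sigma>) * b t"
      using y' by eventually_elim (simp add: f_def b_def algebra_simps)
  qed (use mem mem' star in auto)
  then have identity: "lyapunov M A r s \<theta> (\<lambda>t. x t - us t) (\<lambda>t. y t - ps t)
      - lyapunov M A r s \<theta> (\<lambda>t. x' t - us t) (\<lambda>t. y' t - ps t) = \<rho> * (2 * X + Y)"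
    unfolding old X_def Y_def
    by (simp only: lyapunov_step_identity[OF bl adj par(3) mem'])
  have X: "\<tau> * L2_inner M e e + L2_inner M f f \<le> X"
    unfolding X_def e_def f_def a_def b_def
    by (rule prediction_monotone[OF bl adj uT beta mem(1,2) ut ub pt saddle])
  have "g * ((2 - \<rho>) / r * L2_inner M a a + (2 - \<sigma>) / s * L2_inner M b b) \<le> Y"
    unfolding g_def Y_def
    by (rule correction_form_coercive[OF bl adj rs]) (use par mem' in auto)
  then have Y: "g * ((2 - \<rho>) / r) * L2_inner M a a + g * ((2 - \<sigma>) / s) * L2_inner M b b \<le> Y"
    by (simp only: distrib_left mult.assoc)
  have low: "m * N \<le> c * N" if "m \<le> c" "0 \<le> N" for c N :: real
    using that by (rule mult_right_mono)
  have "m * L2_inner M e e \<le> 2 * \<tau> * L2_inner M e e" "m * L2_inner M f f \<le> 2 * L2_inner M f f"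
    "m * L2_inner M a a \<le> g * ((2 - \<rho>) / r) * L2_inner M a a"
    "m * L2_inner M b b \<le> g * ((2 - \<sigma>) / s) * L2_inner M b b"
    using m by (auto simp only: g_def intro!: low L2_inner_self_nonneg)
  then have XY: "m * (L2_inner M e e + L2_inner M a a + L2_inner M f f + L2_inner M b b) \<le> 2 * X + Y"
    using X Y by (simp only: distrib_left)
  have "m / 2 * ((L2_norm M (\<lambda>t. e t + a t))\<^sup>2 + (L2_norm M (\<lambda>t. f t + b t))\<^sup>2)
      \<le> m / 2 * (2 * (L2_inner M e e + L2_inner M a a) + 2 * (L2_inner M f f + L2_inner M b b))"
    using m(1) mem' by (intro mult_left_mono add_mono L2_norm_add_power2_le) auto
  also have "\<dots> \<le> 2 * X + Y"
    using XY by (simp add: distrib_left)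
  finally have "\<rho> * (m / 2 * ((L2_norm M (\<lambda>t. e t + a t))\<^sup>2 + (L2_norm M (\<lambda>t. f t + b t))\<^sup>2))
      \<le> \<rho> * (2 * X + Y)"
    using par(1) by (intro mult_left_mono) auto
  then show ?thesis
    unfolding identity unfolding old by simp
qed

theorem (in finite_measure) generalized_primal_dual_converges:
  assumes bl: "L2_bounded_linear M A" and adj: "L2_adjoint M A B"
    and uT: "uT \<in> L2 M" and pos: "\<tau> > 0" "\<beta> \<ge> 0" and rs: "r > 0" "s > 0"
    and step: "r * s * L2_onorm M (A \<circ> B) < 1"
    and th: "0 < \<theta>" "\<theta> \<le> 1"
    and one: "\<theta> = 1 \<Longrightarrow> \<rho> = \<sigma> \<and> 0 < \<rho> \<and> \<rho> < 2"
    and less: "\<theta> < 1 \<Longrightarrow> 0 < \<rho> \<and> \<rho> \<le> 1 + \<theta> - sqrt (1 - \<theta>) \<and> \<sigma> = \<rho> / \<theta>"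
    and it: "gpd_iterates M \<tau> \<beta> uT A r s \<theta> \<rho> \<sigma> u p"
    and saddle: "saddle_point M (lagrangian M \<tau> \<beta> uT A) us ps"
  shows "(\<lambda>k. L2_norm M (\<lambda>x. u k x - us x)) \<longlonglongrightarrow> 0"
    and "(\<lambda>k. L2_norm M (\<lambda>x. p k x - ps x)) \<longlonglongrightarrow> 0"
proof -
  note par = relaxation_parameters[OF th one less]
  define g where "g = 1 - sqrt (r * s * L2_onorm M (A \<circ> B))"
  have "0 < g"
    using step by (simp add: g_def)
  define m where "m = Min {2 * \<tau>, 2, g * ((2 - \<rho>) / r), g * ((2 - \<sigma>) / s)}"
  have m: "0 < m"
    unfolding m_def using \<open>0 < g\<close> pos rs par by simp
  have m_le: "m \<le> 2 * \<tau>" "m \<le> 2" "m \<le> g * ((2 - \<rho>) / r)" "m \<le> g * ((2 - \<sigma>) / s)"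
    unfolding m_def by (rule Min_le; simp)+
  define V where "V = (\<lambda>k. lyapunov M A r s \<theta> (\<lambda>x. u k x - us x) (\<lambda>x. p k x - ps x))"
  define D where "D = (\<lambda>k. (L2_norm M (\<lambda>x. u k x - us x))\<^sup>2 + (L2_norm M (\<lambda>x. p k x - ps x))\<^sup>2)"
  have mem: "u k \<in> L2 M" "p k \<in> L2 M" for k
    using it by (cases k; auto simp: gpd_iterates_def)+
  have star: "us \<in> L2 M" "ps \<in> L2 M"
    using saddle by (auto simp: saddle_point_def)
  have "0 \<le> V k" for k
    unfolding V_def by (rule lyapunov_nonneg[OF bl adj rs]) (use step th mem star in auto)
  moreover have "0 \<le> \<rho> * m / 2 * D k" for k
    using m par(1) by (simp add: D_def)
  moreover have "\<rho> * m / 2 * D k \<le> V k - V (Suc k)" for k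
  proof -
    obtain ut ub pt where
      ut: "is_arg_min (\<lambda>w. g_fun M \<tau> \<beta> w + (LINT x|M. p k x * A w x)
             + 1 / (2 * r) * (L2_norm M (\<lambda>x. w x - u k x))\<^sup>2) (\<lambda>w. w \<in> L2 M) ut"
      and ub: "ub = (\<lambda>x. ut x + \<theta> * (ut x - u k x))"
      and pt: "is_arg_max (\<lambda>q. (LINT x|M. q x * A ub x) - f_conj M uT q
             - 1 / (2 * s) * (L2_norm M (\<lambda>x. q x - p k x))\<^sup>2) (\<lambda>q. q \<in> L2 M) pt"
      and u': "AE x in M. u (Suc k) x = u k x - \<rho> * (u k x - ut x)"
      and p': "AE x in M. p (Suc k) x = p k x - \<sigma> * (p k x - pt x)"
      using it unfolding gpd_iterates_def by blast
    show ?thesis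
      unfolding D_def V_def
      by (rule primal_dual_step_dissipation[OF bl adj uT pos(2) rs par less_imp_le[OF m]
            m_le[unfolded g_def] mem mem ut ub pt u' p' saddle])
  qed
  ultimately have "(\<lambda>k. \<rho> * m / 2 * D k) \<longlonglongrightarrow> 0"
    by (rule dissipation_tendsto_zero)
  then have "(\<lambda>k. 2 / (\<rho> * m) * (\<rho> * m / 2 * D k)) \<longlonglongrightarrow> 2 / (\<rho> * m) * 0"
    by (intro tendsto_intros)
  then have "D \<longlonglongrightarrow> 0"
    using m par(1) by simp
  then have root: "(\<lambda>k. sqrt (D k)) \<longlonglongrightarrow> 0"
    using tendsto_real_sqrt by fastforce
  show "(\<lambda>k. L2_norm M (\<lambda>x. u k x - us x)) \<longlonglongrightarrow> 0"
    by (rule tendsto_sandwich[OF _ _ tendsto_const root]) (auto simp: D_def real_le_rsqrt)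
  show "(\<lambda>k. L2_norm M (\<lambda>x. p k x - ps x)) \<longlonglongrightarrow> 0"
    by (rule tendsto_sandwich[OF _ _ tendsto_const root]) (auto simp: D_def real_le_rsqrt)
qed

theorem theorem4p3:
  fixes \<Omega> :: "(real^'n) set"
    and T d \<tau> \<beta> r s \<theta> \<rho> \<sigma> :: real
    and v :: "real^'n"
    and uT us ps :: "real^'n \<Rightarrow> real"
    and L Ladj :: "(real^'n \<Rightarrow> real) \<Rightarrow> (real^'n \<Rightarrow> real)"
    and u p :: "nat \<Rightarrow> real^'n \<Rightarrow> real"
  assumes "open \<Omega>" and "connected \<Omega>" and "\<Omega> \<noteq> {}" and "bounded \<Omega>"
    and "T > 0" and "d > 0" and "\<tau> > 0" and "\<beta> > 0"
    and "uT \<in> L2 (lebesgue_on \<Omega>)"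
    and "solution_operator \<Omega> T d v L"
    and "L2_bounded_linear (lebesgue_on \<Omega>) L"
    and "L2_adjoint (lebesgue_on \<Omega>) L Ladj"
    and "r > 0" and "s > 0"
    and "r * s * L2_onorm (lebesgue_on \<Omega>) (L \<circ> Ladj) < 1"
    and "0 < \<theta>" and "\<theta> \<le> 1"
    and "\<theta> = 1 \<Longrightarrow> \<rho> = \<sigma> \<and> 0 < \<rho> \<and> \<rho> < 2"
    and "\<theta> < 1 \<Longrightarrow> 0 < \<rho> \<and> \<rho> \<le> 1 + \<theta> - sqrt (1 - \<theta>) \<and> \<sigma> = \<rho> / \<theta>"
    and "gpd_iterates (lebesgue_on \<Omega>) \<tau> \<beta> uT L r s \<theta> \<rho> \<sigma> u p"
    and "saddle_point (lebesgue_on \<Omega>) (lagrangian (lebesgue_on \<Omega>) \<tau> \<beta> uT L) us ps"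
  shows "(\<lambda>k. L2_norm (lebesgue_on \<Omega>) (\<lambda>x. u k x - us x)) \<longlonglongrightarrow> 0 \<and>
         (\<lambda>k. L2_norm (lebesgue_on \<Omega>) (\<lambda>x. p k x - ps x)) \<longlonglongrightarrow> 0"
proof -
  have "\<Omega> \<in> lmeasurable"
    using \<open>open \<Omega>\<close> \<open>bounded \<Omega>\<close> by (simp add: lmeasurable_open)
  then interpret finite_measure "lebesgue_on \<Omega>"
    by (rule finite_measure_lebesgue_on)
  from assms show ?thesis
    by (intro conjI generalized_primal_dual_converges[where \<tau> = \<tau> and \<beta> = \<beta> and uT = uT
          and A = L and B = Ladj and r = r and s = s and \<theta> = \<theta> and \<rho> = \<rho> and \<sigma> = \<sigma>
          and u = u and p = p and us = us and ps = ps]) auto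
qed

end
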